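(* In the setting described in the context, suppose the density $f$ satisfies the stated regularity conditions and the constraint function $\mathbf{h}$ satisfies the stated smoothness and rank conditions. If $\delta>0$ is sufficiently small, $0<\epsilon<1$, $n$ is sufficiently large, $\mathbf{x}\in\mathbf{X}_n$ (a set with properties (X1)-(X4) for $\delta,\epsilon$), and $(\hat{\boldsymbol\omega},\hat{\boldsymbol\lambda})$ with $\hat{\boldsymbol\omega}=(\hat{\boldsymbol\phi},\hat{\boldsymbol\psi})\in U_\delta$ is a solution of $$\tfrac1n \mathbf{s}(\mathbf{x},\boldsymbol{\phi})+\mathbf{J}_{\boldsymbol\omega}\boldsymbol\lambda=\mathbf{0},\qquad \mathbf{K}_{\boldsymbol\omega}\boldsymbol\lambda=\mathbf{0},\qquad \mathbf{h}(\boldsymbol\omega)=\mathbf{0},$$ then $\hat{\boldsymbol\omega}$ locally maximizes the log-likelihood subject to the constraints; that is, there is a neighborhood $V$ of $\hat{\boldsymbol\omega}$ in $\mathbb{R}^s$ such that $\ell(\mathbf{x},\boldsymbol\phi)\le\ell(\mathbf{x},\hat{\boldsymbol\phi})$ for every $\boldsymbol\omega=(\boldsymbol\phi,\boldsymbol\psi)\in V$ with $\mathbf{h}(\boldsymbol\omega)=\mathbf{0}$.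
   Context: Setting. Let $r<s$ and $t$ be positive integers with $s-r\le t\le r$. The parameter is $\boldsymbol\omega=(\omega_1,\dots,\omega_s)^T=(\boldsymbol\phi,\boldsymbol\psi)$ with $\boldsymbol\phi=(\omega_1,\dots,\omega_r)^T$ and $\boldsymbol\psi=(\omega_{r+1},\dots,\omega_s)^T$. The data $\mathbf{x}=(x_1,\dots,x_n)^T$ are $n$ independent observations with density $f(x,\boldsymbol\phi^* )$, where $\boldsymbol\omega^*=(\boldsymbol\phi^*,\boldsymbol\psi^* )$ is the true parameter; the log-likelihood is $\ell(\mathbf{x},\boldsymbol\phi)=\sum_{i=1}^n\log f(x_i,\boldsymbol\phi)$ and depends only on $\boldsymbol\phi$. There are $t$ constraints $\mathbf{h}(\boldsymbol\omega)=(h_1(\boldsymbol\omega),\dots,h_t(\boldsymbol\omega))^T=\mathbf{0}$, and $\mathbf{h}(\boldsymbol\omega^* )=\mathbf{0}$. Notation. $\mathbf{s}(\mathbf{x},\boldsymbol\phi)\in\mathbb{R}^r$ is the score vector $(\partial\ell(\mathbf{x},\boldsymbol\phi)/\partial\omega_i)_{i\le r}$; $\mathbf{J}_{\boldsymbol\omega}$ is the $r\times t$ matrix $(\partial h_j(\boldsymbol\omega)/\partial\omega_i)_{i\le r,\,j\le t}$; $\mathbf{K}_{\boldsymbol\omega}$ is the $(s-r)\times t$ matrix $(\partial h_j(\boldsymbol\omega)/\partial\omega_{r+i})_{i\le s-r,\,j\le t}$; $\mathbf{M}_{\mathbf{x},\boldsymbol\phi}$ is the $r\times r$ matrix $(\partial^2\ell(\mathbf{x},\boldsymbol\phi)/\partial\omega_i\partial\omega_j)$.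 For $\rho>0$, $U_\rho=\{\boldsymbol\omega\in\mathbb{R}^s:\|\boldsymbol\omega-\boldsymbol\omega^*\|\le\rho\}$; $\alpha>0$ is fixed. Conditions on $f$ (Cramér-type, from Aitchison and Silvey 1958). For all $\boldsymbol\omega\in U_\alpha$ and almost all $x$, the partial derivatives of $\log f(x,\boldsymbol\phi)$ with respect to $\omega_1,\dots,\omega_r$ up to order three exist; the first and second order partial derivatives of $f(x,\boldsymbol\phi)$ are bounded in modulus, uniformly for $\boldsymbol\omega\in U_\alpha$, by integrable functions $F_1(x)$, $F_2(x)$; the third order partial derivatives of $\log f(x,\boldsymbol\phi)$ are bounded in modulus, uniformly for $\boldsymbol\omega\in U_\alpha$, by a function $F_3(x)$ with $\int F_3(x)f(x,\boldsymbol\phi^* )\,dx<\kappa_1<\infty$; and the Fisher information matrix $\mathbf{B}_{\boldsymbol\phi^*}=\left(\int \frac{\partial\log f(x,\boldsymbol\phi^* )}{\partial\omega_i}\frac{\partial\log f(x,\boldsymbol\phi^* )}{\partial\omega_j}f(x,\boldsymbol\phi^* )\,dx\right)_{i,j\le r}$ is finite and positive definite. These imply: for any positive $\delta<\alpha$ and $\epsilon<1$ there is $n(\delta,\epsilon)$ such that for every $n\ge n(\delta,\epsilon)$ there is a set $\mathbf{X}_n\subset\mathbb{R}^n$ with: (X1) $\Pr\{\mathbf{X}_n\}>1-\epsilon$; and for every $\mathbf{x}\in\mathbf{X}_n$ (for which $\ell(\mathbf{x},\cdot)$ has the derivatives above on $U_\alpha$): (X2) $\|\mathbf{s}(\mathbf{x},\boldsymbol\phi^*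 )/n\|<\delta^2$; (X3) $\mathbf{M}_{\mathbf{x},\boldsymbol\phi^*}/n=-\mathbf{B}_{\boldsymbol\phi^*}+\delta\,\mathbf{m}_{\mathbf{x},\boldsymbol\phi^*}$ where $\mathbf{m}_{\mathbf{x},\boldsymbol\phi^*}$ is an $r\times r$ matrix with entries of modulus at most $1$; (X4) $\left|\frac1n\frac{\partial^3\ell(\mathbf{x},\boldsymbol\phi)}{\partial\omega_i\partial\omega_j\partial\omega_k}\right|<2\kappa_1$ for all $\boldsymbol\omega\in U_\alpha$ and $i,j,k\le r$, with $\kappa_1$ a constant. Conditions on $\mathbf{h}$. For all $\boldsymbol\omega\in U_\alpha$ the first order partial derivatives of every $h_k$ exist and are continuous in $\boldsymbol\omega$; for all $\boldsymbol\omega\in U_\alpha$ the second order partial derivatives of every $h_k$ exist and are bounded in modulus by a constant $2\kappa_2$; $\operatorname{rank}(\mathbf{J}_{\boldsymbol\omega^*})=t$ and $\operatorname{rank}(\mathbf{K}_{\boldsymbol\omega^*})=s-r$. Quantifiers: "$\delta$ sufficiently small, $n$ sufficiently large" means there is $\delta_0\in(0,\alpha]$ such that for every $0<\delta<\delta_0$ and $0<\epsilon<1$ there is $N\ge n(\delta,\epsilon)$ such that the claim holds for all $n\ge N$. *)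

theory Defs
  imports "HOL-Probability.Probability"
begin

(* The full parameter omega = (phi, psi) lives in "(real^'r) \<times> (real^'q)" with s = r + q; the norm
   of the product type is the Euclidean norm of R^s, so the closed ball U_rho about omega* is
   "cball \<omega>s \<rho>".  The coordinate directions are the elements of Basis: (axis i 1, 0) for i <= r
   and (0, axis i 1) for the remaining s - r coordinates. *)

definition pderiv_at :: "'a::euclidean_space \<Rightarrow> ('a \<Rightarrow> real) \<Rightarrow> 'a \<Rightarrow> real" where
  "pderiv_at b g x = deriv (\<lambda>u. g (x + u *\<^sub>R b)) 0"

(* Iterated partial derivatives; the last direction in the list is differentiated first. *)
primrec pderivs :: "'a::euclidean_space list \<Rightarrow> ('a \<Rightarrow> real) \<Rightarrow> 'a \<Rightarrow> real" where
  "pderivs [] g = g"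
| "pderivs (b # bs) g = pderiv_at b (pderivs bs g)"

(* deriv is total, so existence is a separate predicate.  A derivative of order k + 1 exists at x
   if the one of order k exists on the coordinate line near x and is differentiable there at x;
   thus existence of order k includes that of all lower orders at x. *)
primrec pderivs_exist :: "'a::euclidean_space list \<Rightarrow> ('a \<Rightarrow> real) \<Rightarrow> 'a \<Rightarrow> bool" where
  "pderivs_exist [] g x \<longleftrightarrow> True"
| "pderivs_exist (b # bs) g x \<longleftrightarrow>
     (\<forall>\<^sub>F u in nhds 0. pderivs_exist bs g (x + u *\<^sub>R b)) \<and>
     (\<lambda>u. pderivs bs g (x + u *\<^sub>R b)) field_differentiable (at 0)"

definition loglik :: "(real \<Rightarrow> real^'r \<Rightarrow> real) \<Rightarrow> nat \<Rightarrow> (nat \<Rightarrow> real) \<Rightarrow> real^'r \<Rightarrow> real" where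
  "loglik f n x \<phi> = (\<Sum>i<n. ln (f (x i) \<phi>))"

definition score :: "(real \<Rightarrow> real^'r \<Rightarrow> real) \<Rightarrow> nat \<Rightarrow> (nat \<Rightarrow> real) \<Rightarrow> real^'r \<Rightarrow> real^'r" where
  "score f n x \<phi> = (\<chi> i. pderivs [axis i 1] (loglik f n x) \<phi>)"

definition hess_loglik ::
    "(real \<Rightarrow> real^'r \<Rightarrow> real) \<Rightarrow> nat \<Rightarrow> (nat \<Rightarrow> real) \<Rightarrow> real^'r \<Rightarrow> real^'r^'r" where
  "hess_loglik f n x \<phi> = (\<chi> i j. pderivs [axis i 1, axis j 1] (loglik f n x) \<phi>)"

definition fisher_integrand ::
    "(real \<Rightarrow> real^'r \<Rightarrow> real) \<Rightarrow> real^'r \<Rightarrow> 'r \<Rightarrow> 'r \<Rightarrow> real \<Rightarrow> real" where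
  "fisher_integrand f \<phi> i j x =
     pderivs [axis i 1] (\<lambda>p. ln (f x p)) \<phi> * pderivs [axis j 1] (\<lambda>p. ln (f x p)) \<phi> * f x \<phi>"

definition fisher_info :: "(real \<Rightarrow> real^'r \<Rightarrow> real) \<Rightarrow> real^'r \<Rightarrow> real^'r^'r" where
  "fisher_info f \<phi> = (\<chi> i j. LINT x|lborel. fisher_integrand f \<phi> i j x)"

definition Jmat :: "((real^'r) \<times> (real^'q) \<Rightarrow> real^'t) \<Rightarrow> (real^'r) \<times> (real^'q) \<Rightarrow> real^'t^'r" where
  "Jmat h \<omega> = (\<chi> i j. pderivs [(axis i 1, 0)] (\<lambda>w. h w $ j) \<omega>)"

definition Kmat :: "((real^'r) \<times> (real^'q) \<Rightarrow> real^'t) \<Rightarrow> (real^'r) \<times> (real^'q) \<Rightarrow> real^'t^'q" where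
  "Kmat h \<omega> = (\<chi> i j. pderivs [(0, axis i 1)] (\<lambda>w. h w $ j) \<omega>)"

(* ln is total, hence the explicit positivity of f wherever log f is differentiated.
   Existence of the partial derivatives of f itself is inherited from log f. *)
definition density_conditions ::
    "(real \<Rightarrow> real^'r \<Rightarrow> real) \<Rightarrow> (real^'r) \<times> (real^'q) \<Rightarrow> real \<Rightarrow> real \<Rightarrow> bool" where
  "density_conditions f \<omega>s \<alpha> \<kappa>1 \<longleftrightarrow>
     (\<forall>\<omega>\<in>cball \<omega>s \<alpha>. (\<forall>x. 0 \<le> f x (fst \<omega>)) \<and>
        integrable lborel (\<lambda>x. f x (fst \<omega>)) \<and> (LINT x|lborel. f x (fst \<omega>)) = 1) \<and>
     (\<forall>\<omega>\<in>cball \<omega>s \<alpha>. AE x in lborel. 0 < f x (fst \<omega>) \<and>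
        (\<forall>i j k. pderivs_exist [axis i 1, axis j 1, axis k 1] (\<lambda>p. ln (f x p)) (fst \<omega>))) \<and>
     (\<exists>F1 F2. integrable lborel F1 \<and> integrable lborel F2 \<and>
        (\<forall>\<omega>\<in>cball \<omega>s \<alpha>. AE x in lborel. \<forall>i j.
           \<bar>pderivs [axis i 1] (f x) (fst \<omega>)\<bar> \<le> F1 x \<and>
           \<bar>pderivs [axis i 1, axis j 1] (f x) (fst \<omega>)\<bar> \<le> F2 x)) \<and>
     (\<exists>F3. integrable lborel (\<lambda>x. F3 x * f x (fst \<omega>s)) \<and>
        (LINT x|lborel. F3 x * f x (fst \<omega>s)) < \<kappa>1 \<and>
        (\<forall>\<omega>\<in>cball \<omega>s \<alpha>. AE x in lborel. \<forall>i j k.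
           \<bar>pderivs [axis i 1, axis j 1, axis k 1] (\<lambda>p. ln (f x p)) (fst \<omega>)\<bar> \<le> F3 x)) \<and>
     (\<forall>i j. integrable lborel (fisher_integrand f (fst \<omega>s) i j)) \<and>
     (\<forall>v. v \<noteq> 0 \<longrightarrow> 0 < v \<bullet> (fisher_info f (fst \<omega>s) *v v))"

definition constraint_conditions ::
    "((real^'r) \<times> (real^'q) \<Rightarrow> real^'t) \<Rightarrow> (real^'r) \<times> (real^'q) \<Rightarrow> real \<Rightarrow> real \<Rightarrow> bool" where
  "constraint_conditions h \<omega>s \<alpha> \<kappa>2 \<longleftrightarrow>
     (\<forall>k. \<forall>b\<in>Basis.
        (\<forall>\<omega>\<in>cball \<omega>s \<alpha>. pderivs_exist [b] (\<lambda>w. h w $ k) \<omega>) \<and>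
        continuous_on (cball \<omega>s \<alpha>) (pderivs [b] (\<lambda>w. h w $ k))) \<and>
     (\<forall>k. \<forall>b\<in>Basis. \<forall>c\<in>Basis. \<forall>\<omega>\<in>cball \<omega>s \<alpha>.
        pderivs_exist [b, c] (\<lambda>w. h w $ k) \<omega> \<and>
        \<bar>pderivs [b, c] (\<lambda>w. h w $ k) \<omega>\<bar> \<le> 2 * \<kappa>2) \<and>
     rank (Jmat h \<omega>s) = CARD('t) \<and>
     rank (Kmat h \<omega>s) = CARD('q)"

(* Law of n independent observations with density f(., phi); R^n is the extensional function
   space over {..<n}. *)
definition sample_measure :: "(real \<Rightarrow> real^'r \<Rightarrow> real) \<Rightarrow> real^'r \<Rightarrow> nat \<Rightarrow> (nat \<Rightarrow> real) measure" where
  "sample_measure f \<phi> n = (\<Pi>\<^sub>M i\<in>{..<n}. density lborel (\<lambda>x. ennreal (f x \<phi>)))"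

(* The properties (X1)-(X4), for given delta, epsilon and n, of a set X of samples at each of
   which the log-likelihood is defined and three times partially differentiable on U_alpha.
   The theorem ranges over every such X, so the threshold n(delta, epsilon) beyond which such
   sets exist only acts as a lower bound for N and may be an arbitrary function. *)
definition sample_set_props ::
    "(real \<Rightarrow> real^'r \<Rightarrow> real) \<Rightarrow> (real^'r) \<times> (real^'q) \<Rightarrow> real \<Rightarrow> real \<Rightarrow> real \<Rightarrow> real \<Rightarrow> nat
       \<Rightarrow> (nat \<Rightarrow> real) set \<Rightarrow> bool" where
  "sample_set_props f \<omega>s \<alpha> \<kappa>1 \<delta> \<epsilon> n X \<longleftrightarrow>
     X \<in> sets (sample_measure f (fst \<omega>s) n) \<and>
     measure (sample_measure f (fst \<omega>s) n) X > 1 - \<epsilon> \<and>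
     (\<forall>x\<in>X.
        (\<forall>\<omega>\<in>cball \<omega>s \<alpha>. (\<forall>l<n. 0 < f (x l) (fst \<omega>)) \<and>
           (\<forall>i j k. pderivs_exist [axis i 1, axis j 1, axis k 1] (loglik f n x) (fst \<omega>))) \<and>
        norm ((1 / real n) *\<^sub>R score f n x (fst \<omega>s)) < \<delta>\<^sup>2 \<and>
        (\<exists>m::real^'r^'r. (\<forall>i j. \<bar>m $ i $ j\<bar> \<le> 1) \<and>
           (1 / real n) *\<^sub>R hess_loglik f n x (fst \<omega>s) = - fisher_info f (fst \<omega>s) + \<delta> *\<^sub>R m) \<and>
        (\<forall>\<omega>\<in>cball \<omega>s \<alpha>. \<forall>i j k.
           \<bar>(1 / real n) * pderivs [axis i 1, axis j 1, axis k 1] (loglik f n x) (fst \<omega>)\<bar> < 2 * \<kappa>1))"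

end

theory Submission imports Defs begin

text \<open>
  The argument is the second-order sufficient condition, carried out with explicit remainders.
  Let \<open>(a, b)\<close> be the increment from the solution to a nearby feasible point. Feasibility and
  injectivity of \<open>K\<close> transposed give \<open>norm b = O(norm a)\<close>, so stationarity turns the gradient term
  of the scaled log-likelihood into \<open>O(norm \<lambda> * (norm a)\<^sup>2)\<close>. Injectivity of \<open>J\<close> bounds \<open>\<lambda>\<close> by the
  scaled score, which is \<open>O(\<delta>)\<close>, and the scaled Hessian is \<open>- B + O(\<delta>)\<close> with \<open>B\<close> positive definite.
  For small \<open>\<delta>\<close> the negative quadratic term wins, with constants independent of \<open>n\<close> and of the sample.
  Only partial derivatives are known to exist, so every expansion is reduced to the mean value theorem
  along coordinate lines instead of a chain rule.
\<close>

subsection \<open>Expansions from bounds on partial derivatives\<close>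

text \<open>Walk from \<open>x\<close> to \<open>x + v\<close> one coordinate at a time and apply
  the one-dimensional mean value bound on each leg. Only derivatives along coordinate lines enter,
  so no total differentiability is required, at the price of the factor
  \<open>DIM('a)\<close>.\<close>

lemma coordinate_mean_value:
  fixes g :: "'a::euclidean_space \<Rightarrow> real"
  assumes deriv: "\<And>z b. z \<in> cball x (norm v) \<Longrightarrow> b \<in> Basis \<Longrightarrow>
      ((\<lambda>u. g (z + u *\<^sub>R b)) has_real_derivative G b z) (at 0)"
    and bound: "\<And>z b. z \<in> cball x (norm v) \<Longrightarrow> b \<in> Basis \<Longrightarrow> \<bar>G b z\<bar> \<le> C"
  shows "\<bar>g (x + v) - g x\<bar> \<le> C * DIM('a) * norm v"
proof -
  have C: "0 \<le> C"
    using bound[of x] nonempty_Basis by fastforce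
  \<comment> \<open>Induction on the set \<open>S\<close> of coordinates already moved.\<close>
  have partial: "\<bar>g (x + (\<Sum>b\<in>S. (v \<bullet> b) *\<^sub>R b)) - g x\<bar> \<le> C * card S * norm v"
    if "finite S" "S \<subseteq> Basis" for S :: "'a set"
    using that
  proof (induction S rule: finite_induct)
    case empty
    then show ?case by simp
  next
    case (insert c S)
    define p where "p = x + (\<Sum>b\<in>S. (v \<bullet> b) *\<^sub>R b)"
    have c: "c \<in> Basis" and S: "S \<subseteq> Basis" "finite S" "c \<notin> S"
      using insert by auto
    \<comment> \<open>Each component of the partial increment is 0 or at most that of
      \<open>v\<close> in modulus, so the whole leg stays in the ball.\<close>
    have in_ball: "p + u *\<^sub>R c \<in> cball x (norm v)" if u: "\<bar>u\<bar> \<le> \<bar>v \<bullet> c\<bar>" for u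
    proof -
      have "norm ((\<Sum>b\<in>S. (v \<bullet> b) *\<^sub>R b) + u *\<^sub>R c) \<le> norm v"
      proof (rule norm_le_componentwise)
        fix d :: 'a assume d: "d \<in> Basis"
        have "(\<Sum>b\<in>S. (v \<bullet> b) *\<^sub>R b) \<bullet> d = (\<Sum>b\<in>S. if b = d then v \<bullet> d else 0)"
          unfolding inner_sum_left
          using d S by (intro sum.cong) (auto simp: inner_Basis subset_iff)
        also have "\<dots> = (if d \<in> S then v \<bullet> d else 0)"
          using S by simp
        finally show "\<bar>((\<Sum>b\<in>S. (v \<bullet> b) *\<^sub>R b) + u *\<^sub>R c) \<bullet> d\<bar> \<le> \<bar>v \<bullet> d\<bar>"
          using d c S u by (auto simp: inner_add_left inner_Basis)
      qed
      then show ?thesis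
        by (metis (no_types) add.assoc dist_norm mem_cball norm_minus_commute p_def add_diff_cancel_left')
    qed
    have "norm (g (p + (v \<bullet> c) *\<^sub>R c) - g (p + 0 *\<^sub>R c)) \<le> C * norm ((v \<bullet> c) - 0)"
    proof (rule field_differentiable_bound[where S = "closed_segment 0 (v \<bullet> c)"
          and f = "\<lambda>u. g (p + u *\<^sub>R c)" and f' = "\<lambda>u. G c (p + u *\<^sub>R c)"])
      fix u assume "u \<in> closed_segment 0 (v \<bullet> c)"
      then have "\<bar>u\<bar> \<le> \<bar>v \<bullet> c\<bar>"
        by (auto simp: closed_segment_eq_real_ivl split: if_splits)
      note z = in_ball[OF this]
      \<comment> \<open>The hypothesis speaks of a derivative at 0 along the line through the
        current point; a shift of the parameter turns it into a derivative at \<open>u\<close> along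
        the line through \<open>p\<close>.\<close>
      have "((\<lambda>t. g ((p + u *\<^sub>R c) + t *\<^sub>R c)) has_real_derivative G c (p + u *\<^sub>R c)) (at (u - u))"
        using deriv[OF z c] by simp
      then have "((\<lambda>t. g ((p + u *\<^sub>R c) + (t - u) *\<^sub>R c)) has_real_derivative G c (p + u *\<^sub>R c)) (at u)"
        using DERIV_at_within_shift[of "\<lambda>t. g ((p + u *\<^sub>R c) + t *\<^sub>R c)" _ "-u" u UNIV] by simp
      moreover have "(p + u *\<^sub>R c) + (t - u) *\<^sub>R c = p + t *\<^sub>R c" for t
        by (simp add: algebra_simps)
      ultimately show "((\<lambda>u. g (p + u *\<^sub>R c)) has_field_derivative G c (p + u *\<^sub>R c))
          (at u within closed_segment 0 (v \<bullet> c))"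
        by (simp add: has_field_derivative_at_within)
      show "norm (G c (p + u *\<^sub>R c)) \<le> C"
        using bound[OF z c] by simp
    qed auto
    also have "\<dots> \<le> C * norm v"
      using C Basis_le_norm[OF c, of v] by (simp add: mult_left_mono)
    finally have "\<bar>g (p + (v \<bullet> c) *\<^sub>R c) - g p\<bar> \<le> C * norm v"
      by simp
    moreover have "\<bar>g p - g x\<bar> \<le> C * card S * norm v"
      using insert by (simp add: p_def)
    ultimately have "\<bar>g (p + (v \<bullet> c) *\<^sub>R c) - g x\<bar> \<le> C * card (insert c S) * norm v"
      using S by (simp add: algebra_simps)
    moreover have "x + (\<Sum>b\<in>insert c S. (v \<bullet> b) *\<^sub>R b) = p + (v \<bullet> c) *\<^sub>R c"
      using S by (simp add: p_def algebra_simps)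
    ultimately show ?case
      by simp
  qed
  show ?thesis
    using partial[of Basis] by (simp add: euclidean_representation)
qed

text \<open>Subtracting the linear functional with gradient \<open>G0\<close> leaves a function
  whose partial derivatives are at most \<open>C\<close> in modulus, and the mean value bound
  applies to it.\<close>

lemma affine_approximation_error:
  fixes g :: "'a::euclidean_space \<Rightarrow> real"
  assumes deriv: "\<And>z b. z \<in> cball x (norm v) \<Longrightarrow> b \<in> Basis \<Longrightarrow>
      ((\<lambda>u. g (z + u *\<^sub>R b)) has_real_derivative G b z) (at 0)"
    and bound: "\<And>z b. z \<in> cball x (norm v) \<Longrightarrow> b \<in> Basis \<Longrightarrow> \<bar>G b z - G0 b\<bar> \<le> C"
  shows "\<bar>g (x + v) - g x - (\<Sum>b\<in>Basis. G0 b * (v \<bullet> b))\<bar> \<le> C * DIM('a) * norm v"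
proof -
  define w where "w = (\<Sum>b\<in>Basis. G0 b *\<^sub>R b)"
  have w_inner: "w \<bullet> b = G0 b" if "b \<in> Basis" for b
    using that by (simp add: w_def)
  have "\<bar>(g (x + v) - w \<bullet> (x + v)) - (g x - w \<bullet> x)\<bar> \<le> C * DIM('a) * norm v"
  proof (rule coordinate_mean_value)
    fix z b :: 'a assume z: "z \<in> cball x (norm v)" and b: "b \<in> Basis"
    have "((\<lambda>u. g (z + u *\<^sub>R b) - (w \<bullet> z + u * (w \<bullet> b))) has_real_derivative G b z - w \<bullet> b) (at 0)"
      by (rule derivative_eq_intros deriv[OF z b] refl | simp)+
    then show "((\<lambda>u. g (z + u *\<^sub>R b) - w \<bullet> (z + u *\<^sub>R b)) has_real_derivative G b z - G0 b) (at 0)"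
      using w_inner[OF b] by (simp add: inner_add_right)
    show "\<bar>G b z - G0 b\<bar> \<le> C"
      by (rule bound[OF z b])
  qed
  moreover have "w \<bullet> v = (\<Sum>b\<in>Basis. G0 b * (v \<bullet> b))"
    by (simp add: w_def inner_sum_left inner_commute[of v])
  ultimately show ?thesis
    by (simp add: inner_add_right)
qed

text \<open>Comparing with an exactly symmetric \<open>B\<close> makes the symmetry of the Hessian \<open>Q\<close> irrelevant.\<close>
lemma quadratic_approximation_error:
  fixes g :: "'a::euclidean_space \<Rightarrow> real" and B :: "'a \<Rightarrow> 'a"
  assumes deriv: "\<And>z b. z \<in> cball x (norm v) \<Longrightarrow> b \<in> Basis \<Longrightarrow>
      ((\<lambda>u. g (z + u *\<^sub>R b)) has_real_derivative P b z) (at 0)"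
    and deriv2: "\<And>z b c. z \<in> cball x (norm v) \<Longrightarrow> b \<in> Basis \<Longrightarrow> c \<in> Basis \<Longrightarrow>
      ((\<lambda>u. P b (z + u *\<^sub>R c)) has_real_derivative Q c b z) (at 0)"
    and bound: "\<And>z b c. z \<in> cball x (norm v) \<Longrightarrow> b \<in> Basis \<Longrightarrow> c \<in> Basis \<Longrightarrow>
      \<bar>Q c b z + c \<bullet> B b\<bar> \<le> \<eta>"
    and lin: "linear B"
    and sym: "\<And>y z. y \<bullet> B z = z \<bullet> B y"
  shows "\<bar>g (x + v) - g x - (\<Sum>b\<in>Basis. P b x * (v \<bullet> b)) + (v \<bullet> B v) / 2\<bar>
    \<le> \<eta> * (real DIM('a))\<^sup>2 * (norm v)\<^sup>2"
proof -
  have \<eta>: "0 \<le> \<eta>"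
  proof -
    obtain b :: 'a where "b \<in> Basis" using nonempty_Basis by blast
    with bound[of x b b] show ?thesis by fastforce
  qed
  \<comment> \<open>The affine estimate for the first partial \<open>P b\<close>, with slopes
    \<open>- (c \<bullet> B b)\<close>; symmetry of \<open>B\<close> sums these to
    \<open>- (b \<bullet> B (z - x))\<close>.\<close>
  have gradient: "\<bar>P b z + b \<bullet> B (z - x) - P b x\<bar> \<le> \<eta> * DIM('a) * norm v"
    if z: "z \<in> cball x (norm v)" and b: "b \<in> Basis" for z b
  proof -
    have le: "norm (z - x) \<le> norm v"
      using z by (simp add: dist_norm norm_minus_commute)
    have "\<bar>P b (x + (z - x)) - P b x - (\<Sum>c\<in>Basis. - (c \<bullet> B b) * ((z - x) \<bullet> c))\<bar>
        \<le> \<eta> * DIM('a) * norm (z - x)"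
    proof (rule affine_approximation_error)
      fix y c :: 'a assume "y \<in> cball x (norm (z - x))" and c: "c \<in> Basis"
      then have y: "y \<in> cball x (norm v)" using le by simp
      show "((\<lambda>u. P b (y + u *\<^sub>R c)) has_real_derivative Q c b y) (at 0)"
        by (rule deriv2[OF y b c])
      show "\<bar>Q c b y - - (c \<bullet> B b)\<bar> \<le> \<eta>"
        using bound[OF y b c] by simp
    qed
    moreover have "(\<Sum>c\<in>Basis. - (c \<bullet> B b) * ((z - x) \<bullet> c)) = - (b \<bullet> B (z - x))"
      using euclidean_inner[of "z - x" "B b"] sym[of b "z - x"]
      by (simp add: sum_negf inner_commute mult.commute)
    moreover have "\<eta> * DIM('a) * norm (z - x) \<le> \<eta> * DIM('a) * norm v"
      using le \<eta> by (intro mult_left_mono) auto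
    ultimately show ?thesis by simp
  qed
  \<comment> \<open>Adding half the quadratic form of \<open>B\<close> centred at \<open>x\<close>
    gives a function whose partials stay close to the constants \<open>P b x\<close>, so the affine
    estimate applies again. The two factors \<open>norm v\<close> come from the variation of the
    gradient and from the step itself.\<close>
  have "\<bar>(g (x + v) + ((x + v - x) \<bullet> B (x + v - x)) / 2) - (g x + ((x - x) \<bullet> B (x - x)) / 2)
      - (\<Sum>b\<in>Basis. P b x * (v \<bullet> b))\<bar> \<le> (\<eta> * DIM('a) * norm v) * DIM('a) * norm v"
  proof (rule affine_approximation_error)
    fix z b :: 'a assume z: "z \<in> cball x (norm v)" and b: "b \<in> Basis"
    define d where "d = z - x"
    have expand: "((z + u *\<^sub>R b - x) \<bullet> B (z + u *\<^sub>R b - x)) / 2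
        = (d \<bullet> B d) / 2 + u * (b \<bullet> B d) + u\<^sup>2 * (b \<bullet> B b) / 2" for u
    proof -
      have "z + u *\<^sub>R b - x = d + u *\<^sub>R b"
        by (simp add: d_def)
      then show ?thesis
        using sym[of b d] by (simp add: linear_add[OF lin] linear_scale[OF lin] inner_add_left
            inner_add_right power2_eq_square algebra_simps)
    qed
    have "((\<lambda>u. g (z + u *\<^sub>R b) + ((d \<bullet> B d) / 2 + u * (b \<bullet> B d) + u\<^sup>2 * (b \<bullet> B b) / 2))
        has_real_derivative P b z + b \<bullet> B (z - x)) (at 0)"
      by (rule derivative_eq_intros deriv[OF z b] refl | simp add: d_def)+
    then show "((\<lambda>u. g (z + u *\<^sub>R b) + ((z + u *\<^sub>R b - x) \<bullet> B (z + u *\<^sub>R b - x)) / 2)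
        has_real_derivative P b z + b \<bullet> B (z - x)) (at 0)"
      by (simp add: expand)
    show "\<bar>P b z + b \<bullet> B (z - x) - P b x\<bar> \<le> \<eta> * DIM('a) * norm v"
      by (rule gradient[OF z b])
  qed
  then show ?thesis
    by (simp add: linear_0[OF lin] power2_eq_square algebra_simps)
qed

section \<open>Iterated partial derivatives and coordinate bases\<close>

lemma pderivs_exist_tl:
  "pderivs_exist (b # bs) g x \<Longrightarrow> pderivs_exist bs g x"
  by (auto dest: eventually_nhds_x_imp_x)

text \<open>Since \<open>deriv\<close> is total, existence has to come from
  \<open>pderivs_exist\<close>. A derivative at 0 along a coordinate line is the form in which the
  expansion lemmas take their hypotheses.\<close>

lemma pderivs_has_real_derivative:
  "pderivs_exist (b # bs) g x \<Longrightarrow>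
    ((\<lambda>u. pderivs bs g (x + u *\<^sub>R b)) has_real_derivative pderivs (b # bs) g x) (at 0)"
  by (simp add: pderiv_at_def DERIV_deriv_iff_field_differentiable)

lemma Basis_cart_real: "(Basis :: (real^'n) set) = range (\<lambda>i. axis i 1)"
  by (auto simp: Basis_vec_def)

lemma sum_Basis_cart: "(\<Sum>b\<in>Basis. F b) = (\<Sum>i\<in>UNIV. F (axis i 1 :: real^'n))"
  unfolding Basis_cart_real by (subst sum.reindex) (auto simp: inj_on_def axis_eq_axis)

lemma sum_Basis_prod:
  "(\<Sum>b\<in>Basis. F b) = (\<Sum>i\<in>Basis. F (i, 0)) + (\<Sum>i\<in>Basis. F (0, i))"
proof -
  have "(\<Sum>b\<in>(\<lambda>u. (u, 0)) ` Basis \<union> (\<lambda>u. (0, u)) ` Basis. F b)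
      = (\<Sum>b\<in>(\<lambda>u. (u, 0)) ` Basis. F b) + (\<Sum>b\<in>(\<lambda>u. (0, u)) ` Basis. F b)"
    by (rule sum.union_disjoint) auto
  then show ?thesis
    unfolding Basis_prod_def by (simp add: sum.reindex inj_on_def)
qed

section \<open>Norm estimates from entries, and coercivity of positive definite matrices\<close>

lemma norm_le_card_mult_component_bound:
  fixes w :: "real^'n" and e :: real
  assumes "\<And>i. \<bar>w $ i\<bar> \<le> e"
  shows "norm w \<le> CARD('n) * e"
  using norm_le_l1_cart[of w] sum_bounded_above[of UNIV "\<lambda>i. \<bar>w $ i\<bar>" e] assms by fastforce

lemma norm_matrix_vector_mult_le:
  fixes A :: "real^'n^'m" and e :: real
  assumes "\<And>i j. \<bar>A $ i $ j\<bar> \<le> e"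
  shows "norm (A *v v) \<le> real CARD('m) * (real CARD('n) * e * norm v)"
proof (rule norm_le_card_mult_component_bound)
  fix i
  have "\<bar>(A *v v) $ i\<bar> \<le> (\<Sum>j\<in>UNIV. \<bar>A $ i $ j\<bar> * \<bar>v $ j\<bar>)"
    unfolding matrix_vector_mult_def by (auto simp: abs_mult intro: sum_abs[THEN order_trans])
  also have "\<dots> \<le> (\<Sum>j\<in>(UNIV::'n set). e * norm v)"
    using assms by (intro sum_mono mult_mono) (auto simp: component_le_norm_cart intro: order_trans[OF abs_ge_zero])
  finally show "\<bar>(A *v v) $ i\<bar> \<le> CARD('n) * e * norm v"
    by simp
qed

text \<open>The quadratic form attains a positive minimum on the compact unit sphere, and
  homogeneity of degree two extends the bound to all vectors.\<close>

lemma posdef_lower_bound: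
  fixes A :: "real^'n^'n"
  assumes "\<And>v. v \<noteq> 0 \<Longrightarrow> 0 < v \<bullet> (A *v v)"
  obtains c where "c > 0" "\<And>v. c * (norm v)\<^sup>2 \<le> v \<bullet> (A *v v)"
proof -
  have "continuous_on (sphere 0 1) (\<lambda>v. v \<bullet> (A *v v))"
    by (intro continuous_intros)
  moreover have "sphere (0::real^'n) 1 \<noteq> {}"
    by simp
  ultimately obtain w where w: "w \<in> sphere 0 1"
    and min: "\<And>v. v \<in> sphere 0 1 \<Longrightarrow> w \<bullet> (A *v w) \<le> v \<bullet> (A *v v)"
    using continuous_attains_inf[of "sphere (0::real^'n) 1"] compact_sphere by blast
  have "w \<bullet> (A *v w) * (norm v)\<^sup>2 \<le> v \<bullet> (A *v v)" for v
  proof (cases "v = 0")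
    case False
    define u where "u = v /\<^sub>R norm v"
    have "w \<bullet> (A *v w) \<le> u \<bullet> (A *v u)"
      using False by (intro min) (simp add: u_def)
    moreover have "v = norm v *\<^sub>R u"
      using False by (simp add: u_def)
    then have "v \<bullet> (A *v v) = (norm v)\<^sup>2 * (u \<bullet> (A *v u))"
      by (metis inner_scaleR_left inner_scaleR_right matrix_vector_mult_scaleR mult.assoc power2_eq_square)
    ultimately show ?thesis
      by (simp add: mult.commute mult_right_mono)
  qed simp
  moreover have "0 < w \<bullet> (A *v w)"
    using w by (intro assms) auto
  ultimately show ?thesis
    using that by blast
qed

subsection \<open>The constraints\<close>

text \<open>Stated as an eventuality so that several smallness requirements can be met by one
  radius.\<close>

lemma eventually_at_right_mult_less:
  "0 < b \<Longrightarrow> \<forall>\<^sub>F \<delta> in at_right (0::real). A * \<delta> < b"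
proof -
  assume "0 < b"
  have "((\<lambda>\<delta>. A * \<delta>) \<longlongrightarrow> A * 0) (at_right 0)"
    by (intro tendsto_intros)
  with \<open>0 < b\<close> show ?thesis
    by (intro order_tendstoD(2)) auto
qed

lemma constraint_derivatives:
  assumes "constraint_conditions h \<omega>s \<alpha> \<kappa>" "z \<in> cball \<omega>s \<alpha>" "b \<in> Basis" "c \<in> Basis"
  shows "((\<lambda>u. h (z + u *\<^sub>R b) $ k) has_real_derivative pderivs [b] (\<lambda>w. h w $ k) z) (at 0)"
    and "((\<lambda>u. pderivs [c] (\<lambda>w. h w $ k) (z + u *\<^sub>R b)) has_real_derivative
          pderivs [b, c] (\<lambda>w. h w $ k) z) (at 0)"
    and "\<bar>pderivs [b, c] (\<lambda>w. h w $ k) z\<bar> \<le> 2 * \<kappa>"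
proof -
  have ex: "pderivs_exist [b] (\<lambda>w. h w $ k) z" "pderivs_exist [b, c] (\<lambda>w. h w $ k) z"
    using assms unfolding constraint_conditions_def by blast+
  show "((\<lambda>u. h (z + u *\<^sub>R b) $ k) has_real_derivative pderivs [b] (\<lambda>w. h w $ k) z) (at 0)"
    using pderivs_has_real_derivative[OF ex(1)] by simp
  show "((\<lambda>u. pderivs [c] (\<lambda>w. h w $ k) (z + u *\<^sub>R b)) has_real_derivative
          pderivs [b, c] (\<lambda>w. h w $ k) z) (at 0)"
    by (rule pderivs_has_real_derivative[OF ex(2)])
  show "\<bar>pderivs [b, c] (\<lambda>w. h w $ k) z\<bar> \<le> 2 * \<kappa>"
    using assms unfolding constraint_conditions_def by blast
qed

lemma constraint_partials_lipschitz:
  fixes h :: "(real^'r) \<times> (real^'q) \<Rightarrow> real^'t"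
  assumes cc: "constraint_conditions h \<omega>s \<alpha> \<kappa>"
    and sub: "cball x (norm v) \<subseteq> cball \<omega>s \<alpha>" and c: "c \<in> Basis"
  shows "\<bar>pderivs [c] (\<lambda>w. h w $ k) (x + v) - pderivs [c] (\<lambda>w. h w $ k) x\<bar>
    \<le> 2 * \<kappa> * DIM((real^'r) \<times> (real^'q)) * norm v"
  by (rule coordinate_mean_value) (use constraint_derivatives(2,3)[OF cc _ _ c] sub in blast)+

text \<open>The matrices are taken at \<open>y\<close> while the increment starts at
  \<open>x\<close>, because two positions are needed: \<open>y = \<omega>s\<close> gives access to
  the rank conditions, and \<open>y = x\<close> leaves a remainder quadratic in
  \<open>norm v\<close>. On the ball about \<open>x\<close> the first partials differ from those at
  \<open>y\<close> by at most a multiple of \<open>norm (x - y) + norm v\<close>, which feeds the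
  affine estimate.\<close>

lemma constraint_approximation_error:
  fixes h :: "(real^'r) \<times> (real^'q) \<Rightarrow> real^'t"
  assumes cc: "constraint_conditions h \<omega>s \<alpha> \<kappa>"
    and sub: "cball y (norm (x - y) + norm v) \<subseteq> cball \<omega>s \<alpha>"
  shows "norm ((fst v v* Jmat h y + snd v v* Kmat h y) - (h (x + v) - h x))
    \<le> real CARD('t) * (2 * \<kappa> * (real DIM((real^'r) \<times> (real^'q)))\<^sup>2) * (norm (x - y) + norm v) * norm v"
proof -
  define D where "D = real DIM((real^'r) \<times> (real^'q))"
  define R where "R = norm (x - y) + norm v"
  have comp: "\<bar>((fst v v* Jmat h y + snd v v* Kmat h y) - (h (x + v) - h x)) $ k\<bar>
      \<le> 2 * \<kappa> * D * R * D * norm v" for k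
  proof -
    have "\<bar>h (x + v) $ k - h x $ k - (\<Sum>b\<in>Basis. pderivs [b] (\<lambda>w. h w $ k) y * (v \<bullet> b))\<bar>
        \<le> 2 * \<kappa> * D * R * DIM((real^'r) \<times> (real^'q)) * norm v"
    proof (rule affine_approximation_error)
      fix z b :: "(real^'r) \<times> (real^'q)"
      assume "z \<in> cball x (norm v)" and b: "b \<in> Basis"
      then have zy: "norm (z - y) \<le> R"
        using norm_triangle_ineq[of "z - x" "x - y"] by (simp add: R_def dist_norm norm_minus_commute)
      then have "z \<in> cball y R" "cball y (norm (z - y)) \<subseteq> cball y R"
        by (auto simp: dist_norm norm_minus_commute)
      then have z: "z \<in> cball \<omega>s \<alpha>" and sub': "cball y (norm (z - y)) \<subseteq> cball \<omega>s \<alpha>"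
        using sub unfolding R_def by blast+
      show "((\<lambda>u. h (z + u *\<^sub>R b) $ k) has_real_derivative pderivs [b] (\<lambda>w. h w $ k) z) (at 0)"
        by (rule constraint_derivatives(1)[OF cc z b b])
      have "0 \<le> 2 * \<kappa>"
        using constraint_derivatives(3)[OF cc z b b] abs_ge_zero order_trans by blast
      then have "2 * \<kappa> * D * norm (z - y) \<le> 2 * \<kappa> * D * R"
        using zy by (intro mult_left_mono) (auto simp: D_def)
      then show "\<bar>pderivs [b] (\<lambda>w. h w $ k) z - pderivs [b] (\<lambda>w. h w $ k) y\<bar> \<le> 2 * \<kappa> * D * R"
        using constraint_partials_lipschitz[OF cc sub' b, of k] by (simp add: D_def)
    qed
    moreover have "(\<Sum>b\<in>Basis. pderivs [b] (\<lambda>w. h w $ k) y * (v \<bullet> b))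
        = (fst v v* Jmat h y + snd v v* Kmat h y) $ k"
      by (simp add: sum_Basis_prod sum_Basis_cart Jmat_def Kmat_def vector_matrix_mult_def
          inner_prod_def inner_axis mult.commute)
    ultimately show ?thesis
      by (simp add: D_def)
  qed
  show ?thesis
    using norm_le_card_mult_component_bound[OF comp]
    by (simp add: D_def R_def power2_eq_square algebra_simps)
qed

text \<open>This carries the injectivity of \<open>J\<close>, known at \<open>\<omega>s\<close>,
  over to nearby points.\<close>

lemma Jmat_lipschitz:
  fixes h :: "(real^'r) \<times> (real^'q) \<Rightarrow> real^'t"
  assumes cc: "constraint_conditions h \<omega>s \<alpha> \<kappa>" and x: "x \<in> cball \<omega>s \<alpha>"
  shows "norm (Jmat h x *v lam - Jmat h \<omega>s *v lam)
    \<le> real CARD('r) * (real CARD('t) * (2 * \<kappa> * DIM((real^'r) \<times> (real^'q)) * norm (x - \<omega>s)) * norm lam)"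
  unfolding matrix_vector_mult_diff_rdistrib[symmetric]
proof (rule norm_matrix_vector_mult_le)
  fix i :: 'r and j :: 't
  have "(axis i 1, 0) \<in> (Basis :: ((real^'r) \<times> (real^'q)) set)"
    by (simp add: Basis_prod_def Basis_cart_real)
  then show "\<bar>(Jmat h x - Jmat h \<omega>s) $ i $ j\<bar>
      \<le> 2 * \<kappa> * DIM((real^'r) \<times> (real^'q)) * norm (x - \<omega>s)"
    using constraint_partials_lipschitz[OF cc, of \<omega>s "x - \<omega>s" "(axis i 1, 0)" j] x
    by (auto simp: Jmat_def dist_norm norm_minus_commute subset_iff)
qed

text \<open>On the constraint set, injectivity of \<open>K\<close> transposed bounds the \<open>\<psi>\<close>-increment by the
  \<open>\<phi>\<close>-increment, and injectivity of \<open>J\<close> bounds the multiplier by the gradient \<open>g\<close>; since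
  \<open>g \<bullet> fst v\<close> is minus the multiplier applied to the linear part of \<open>h (x + v) - h x = 0\<close>,
  only the quadratic remainder is left.\<close>
lemma feasible_gradient_bound:
  fixes h :: "(real^'r) \<times> (real^'q) \<Rightarrow> real^'t"
  assumes cc: "constraint_conditions h \<omega>s \<alpha> \<kappa>" and \<alpha>: "0 < \<alpha>"
  obtains C \<rho> where "0 \<le> C" "0 < \<rho>" "2 * \<rho> < \<alpha>"
    "\<And>x v g lam. norm (x - \<omega>s) \<le> \<rho> \<Longrightarrow> norm v \<le> \<rho> \<Longrightarrow> g + Jmat h x *v lam = 0 \<Longrightarrow>
      Kmat h x *v lam = 0 \<Longrightarrow> h x = 0 \<Longrightarrow> h (x + v) = 0 \<Longrightarrow>
      g \<bullet> fst v \<le> C * norm g * (norm (fst v))\<^sup>2"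
proof -
  have "inj ((*v) (Jmat h \<omega>s))"
    using cc by (simp add: constraint_conditions_def flip: full_rank_injective)
  then obtain j where j: "j > 0" "\<And>y. j * norm y \<le> norm (Jmat h \<omega>s *v y)"
    using linear_inj_bounded_below_pos[of "(*v) (Jmat h \<omega>s)"] by (auto simp: matrix_vector_mul_linear)
  have "inj ((*v) (transpose (Kmat h \<omega>s)))"
    using cc by (simp add: constraint_conditions_def rank_transpose flip: full_rank_injective)
  then obtain k where k: "k > 0" "\<And>y. k * norm y \<le> norm (y v* Kmat h \<omega>s)"
    using linear_inj_bounded_below_pos[of "(*v) (transpose (Kmat h \<omega>s))"]
    by (auto simp: matrix_vector_mul_linear)
  obtain C1 where C1: "C1 > 0" "\<And>y. norm (y v* Jmat h \<omega>s) \<le> C1 * norm y"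
    using linear_bounded_pos[of "(*v) (transpose (Jmat h \<omega>s))"] by (auto simp: matrix_vector_mul_linear)
  define H where "H = real CARD('t) * (2 * \<kappa> * (real DIM((real^'r) \<times> (real^'q)))\<^sup>2)"
  define G where "G = real CARD('r) * (real CARD('t) * (2 * \<kappa> * DIM((real^'r) \<times> (real^'q))))"
  have "0 \<le> 2 * \<kappa>"
  proof -
    obtain b :: "(real^'r) \<times> (real^'q)" where b: "b \<in> Basis" using nonempty_Basis by blast
    show ?thesis
      using constraint_derivatives(3)[OF cc _ b b, of \<omega>s] \<alpha> by fastforce
  qed
  then have HG: "0 \<le> H" "0 \<le> G"
    unfolding H_def G_def by auto
  \<comment> \<open>The first requirement keeps \<open>x\<close> and \<open>x + v\<close> in the
    ball of radius \<open>\<alpha>\<close>, the second preserves half of the lower bound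
    \<open>j\<close> when \<open>J\<close> is moved from \<open>\<omega>s\<close> to
    \<open>x\<close>, and the third lets the constraint remainder be absorbed by the lower bound
    \<open>k\<close>.\<close>
  have "\<forall>\<^sub>F \<rho> in at_right 0. 2 * \<rho> < \<alpha> \<and> G * \<rho> < j / 2 \<and> (2 * H) * \<rho> < k / 2 \<and> 0 < \<rho>"
    using \<alpha> j(1) k(1)
    by (intro eventually_conj eventually_at_right_mult_less) (auto simp: eventually_at_right_less)
  then obtain \<rho> where \<rho>: "2 * \<rho> < \<alpha>" "G * \<rho> < j / 2" "(2 * H) * \<rho> < k / 2" "0 < \<rho>"
    using eventually_happens'[OF trivial_limit_at_right_real] by blast
  \<comment> \<open>The factor found below for \<open>norm (snd v)\<close> is
    \<open>2 * C1 / k + 1\<close>; one more unit accounts for \<open>norm (fst v)\<close>.\<close>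
  define C2 where "C2 = 2 * C1 / k + 2"
  have C2: "C2 > 0" using C1 k by (simp add: C2_def add_pos_pos)
  have main: "g \<bullet> fst v \<le> 2 / j * H * C2\<^sup>2 * norm g * (norm (fst v))\<^sup>2"
    if x: "norm (x - \<omega>s) \<le> \<rho>" and v: "norm v \<le> \<rho>" and stat: "g + Jmat h x *v lam = 0"
      "Kmat h x *v lam = 0" and feas: "h x = 0" "h (x + v) = 0" for x v g lam
  proof -
    let ?a = "fst v" and ?b = "snd v"
    have v_le: "norm v \<le> norm ?a + norm ?b"
      by (simp add: norm_prod_def sqrt_sum_squares_le_sum)
    have x_in: "x \<in> cball \<omega>s \<alpha>"
      using x \<rho> by (simp add: dist_norm norm_minus_commute)
    \<comment> \<open>Both points are feasible, so the linear part at \<open>\<omega>s\<close>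
      consists of remainder only. It is at most \<open>k / 2\<close> times the increment, and half
      of \<open>k * norm ?b\<close> survives on the left.\<close>
    have "norm (?a v* Jmat h \<omega>s + ?b v* Kmat h \<omega>s) \<le> H * (norm (x - \<omega>s) + norm v) * norm v"
      using constraint_approximation_error[OF cc, of \<omega>s x v] x v \<rho> feas
      by (simp add: H_def subset_iff)
    also have "\<dots> \<le> H * (2 * \<rho>) * norm v"
      using x v HG by (intro mult_right_mono mult_left_mono) auto
    also have "\<dots> \<le> k / 2 * (norm ?a + norm ?b)"
      using \<rho> v_le k by (intro mult_mono) auto
    finally have "norm (?b v* Kmat h \<omega>s) \<le> norm (?a v* Jmat h \<omega>s) + k / 2 * (norm ?a + norm ?b)"
      using norm_triangle_ineq4[of "?a v* Jmat h \<omega>s + ?b v* Kmat h \<omega>s" "?a v* Jmat h \<omega>s"] by simp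
    then have "k * norm ?b \<le> C1 * norm ?a + k / 2 * (norm ?a + norm ?b)"
      using k(2)[of ?b] C1(2)[of ?a] by linarith
    then have "norm ?b \<le> (2 * C1 / k + 1) * norm ?a"
      using k(1) by (simp add: field_simps)
    then have v_a: "norm v \<le> C2 * norm ?a"
      using v_le by (simp add: C2_def algebra_simps)
    have "norm (Jmat h x *v lam - Jmat h \<omega>s *v lam) \<le> G * norm (x - \<omega>s) * norm lam"
      using Jmat_lipschitz[OF cc x_in, of lam] by (simp add: G_def algebra_simps)
    also have "\<dots> \<le> j / 2 * norm lam"
      using x \<rho> HG mult_left_mono[OF x, of G] by (intro mult_right_mono) auto
    finally have "j * norm lam \<le> norm (Jmat h x *v lam) + j / 2 * norm lam"
      using j(2)[of lam] norm_triangle_ineq4[of "Jmat h x *v lam" "Jmat h x *v lam - Jmat h \<omega>s *v lam"]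
      by simp
    moreover have J_lam: "Jmat h x *v lam = - g"
      using stat(1) by (simp add: add_eq_0_iff)
    ultimately have lam: "norm lam \<le> 2 / j * norm g"
      using j(1) by (simp add: field_simps)
    have sub_x: "cball x (norm v) \<subseteq> cball \<omega>s \<alpha>"
    proof
      fix z assume "z \<in> cball x (norm v)"
      then show "z \<in> cball \<omega>s \<alpha>"
        using dist_triangle[of \<omega>s z x] x v \<rho> by (simp add: dist_norm norm_minus_commute)
    qed
    have rem: "norm (?a v* Jmat h x + ?b v* Kmat h x) \<le> H * norm v * norm v"
      using constraint_approximation_error[OF cc, of x x v] sub_x feas by (simp add: H_def)
    \<comment> \<open>Since \<open>Kmat h x *v lam = 0\<close>, the \<open>K\<close> term can be
      added freely; it completes the linear part of \<open>h\<close> whose size is bounded in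
      \<open>rem\<close>.\<close>
    have "g \<bullet> ?a = - ((?a v* Jmat h x + ?b v* Kmat h x) \<bullet> lam)"
      by (simp add: inner_add_left dot_lmul_matrix J_lam stat inner_commute[of g])
    also have "\<dots> \<le> norm (?a v* Jmat h x + ?b v* Kmat h x) * norm lam"
      using norm_cauchy_schwarz[of "?a v* Jmat h x + ?b v* Kmat h x" "- lam"] by simp
    also have "\<dots> \<le> (H * norm v * norm v) * (2 / j * norm g)"
      using rem lam HG by (intro mult_mono) auto
    also have "\<dots> \<le> (H * (C2 * norm ?a) * (C2 * norm ?a)) * (2 / j * norm g)"
      using v_a HG j C2 by (intro mult_mono) auto
    finally show ?thesis
      by (simp add: power2_eq_square mult_ac)
  qed
  show thesis
    by (rule that[of "2 / j * H * C2\<^sup>2" \<rho>]) (use main \<rho> HG j in auto)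
qed

subsection \<open>The log-likelihood\<close>

lemma sample_derivatives:
  fixes f :: "real \<Rightarrow> real^'r \<Rightarrow> real" and \<omega>s :: "(real^'r) \<times> (real^'q)"
  assumes props: "sample_set_props f \<omega>s \<alpha> \<kappa> \<delta> \<epsilon> n X" and x: "x \<in> X"
    and z: "z \<in> cball (fst \<omega>s) \<alpha>" and b: "b \<in> Basis" and c: "c \<in> Basis" and d: "d \<in> Basis"
  defines "L \<equiv> \<lambda>bs z. (1 / real n) * pderivs bs (loglik f n x) z"
  shows "((\<lambda>u. L [] (z + u *\<^sub>R b)) has_real_derivative L [b] z) (at 0)"
    and "((\<lambda>u. L [b] (z + u *\<^sub>R c)) has_real_derivative L [c, b] z) (at 0)"
    and "((\<lambda>u. L [c, b] (z + u *\<^sub>R d)) has_real_derivative L [d, c, b] z) (at 0)"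
    and "\<bar>L [d, c, b] z\<bar> \<le> 2 * \<kappa>"
proof -
  \<comment> \<open>The sample conditions range over the full parameter, so \<open>z\<close> is
    paired with the true value of the remaining coordinates, which leaves its distance to the centre
    unchanged.\<close>
  have \<omega>: "(z, snd \<omega>s) \<in> cball \<omega>s \<alpha>"
    using z by (simp add: dist_prod_def)
  have "pderivs_exist [d, c, b] (loglik f n x) (fst (z, snd \<omega>s)) \<and> \<bar>L [d, c, b] (fst (z, snd \<omega>s))\<bar> < 2 * \<kappa>"
    using props x \<omega> b c d unfolding sample_set_props_def L_def Basis_cart_real by blast
  then have ex: "pderivs_exist [d, c, b] (loglik f n x) z" and "\<bar>L [d, c, b] z\<bar> < 2 * \<kappa>"
    by simp_all
  then show "\<bar>L [d, c, b] z\<bar> \<le> 2 * \<kappa>"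
    by simp
  note ex2 = pderivs_exist_tl[OF ex]
  show "((\<lambda>u. L [] (z + u *\<^sub>R b)) has_real_derivative L [b] z) (at 0)"
    unfolding L_def by (rule DERIV_cmult pderivs_has_real_derivative pderivs_exist_tl[OF ex2])+
  show "((\<lambda>u. L [b] (z + u *\<^sub>R c)) has_real_derivative L [c, b] z) (at 0)"
    unfolding L_def by (rule DERIV_cmult pderivs_has_real_derivative ex2)+
  show "((\<lambda>u. L [c, b] (z + u *\<^sub>R d)) has_real_derivative L [d, c, b] z) (at 0)"
    unfolding L_def by (rule DERIV_cmult pderivs_has_real_derivative ex)+
qed

text \<open>At the true parameter (X3) gives an error of at most \<open>\<delta>\<close>; away from
  it the bound (X4) on third derivatives makes each Hessian entry Lipschitz.\<close>

lemma sample_hessian_error: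
  fixes f :: "real \<Rightarrow> real^'r \<Rightarrow> real" and \<omega>s :: "(real^'r) \<times> (real^'q)"
  assumes props: "sample_set_props f \<omega>s \<alpha> \<kappa> \<delta> \<epsilon> n X" and x: "x \<in> X" and \<delta>: "0 < \<delta>"
    and z: "z \<in> cball (fst \<omega>s) \<alpha>" and b: "b \<in> Basis" and c: "c \<in> Basis"
  shows "\<bar>(1 / real n) * pderivs [c, b] (loglik f n x) z + c \<bullet> (fisher_info f (fst \<omega>s) *v b)\<bar>
    \<le> \<delta> + 2 * \<kappa> * real CARD('r) * norm (z - fst \<omega>s)"
proof -
  let ?Q = "\<lambda>z. (1 / real n) * pderivs [c, b] (loglik f n x) z"
  have "\<bar>?Q (fst \<omega>s + (z - fst \<omega>s)) - ?Q (fst \<omega>s)\<bar> \<le> 2 * \<kappa> * real DIM(real^'r) * norm (z - fst \<omega>s)"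
  proof (rule coordinate_mean_value)
    fix y d :: "real^'r" assume "y \<in> cball (fst \<omega>s) (norm (z - fst \<omega>s))" and d: "d \<in> Basis"
    then have y: "y \<in> cball (fst \<omega>s) \<alpha>"
      using z by (simp add: dist_norm norm_minus_commute)
    note D = sample_derivatives(3,4)[OF props x y b c d]
    show "((\<lambda>u. ?Q (y + u *\<^sub>R d)) has_real_derivative
        (1 / real n) * pderivs [d, c, b] (loglik f n x) y) (at 0)"
      by (rule D(1))
    show "\<bar>(1 / real n) * pderivs [d, c, b] (loglik f n x) y\<bar> \<le> 2 * \<kappa>"
      by (rule D(2))
  qed
  moreover have "\<bar>?Q (fst \<omega>s) + c \<bullet> (fisher_info f (fst \<omega>s) *v b)\<bar> \<le> \<delta>"
  proof -
    obtain i j where ij: "c = axis i 1" "b = axis j 1"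
      using b c by (auto simp: Basis_cart_real)
    obtain m :: "real^'r^'r" where m: "\<bar>m $ i $ j\<bar> \<le> 1"
      and eq: "(1 / real n) *\<^sub>R hess_loglik f n x (fst \<omega>s) = - fisher_info f (fst \<omega>s) + \<delta> *\<^sub>R m"
      using props x unfolding sample_set_props_def by blast
    have "?Q (fst \<omega>s) = - fisher_info f (fst \<omega>s) $ i $ j + \<delta> * m $ i $ j"
      using arg_cong[OF eq, of "\<lambda>A. A $ i $ j"] by (simp add: hess_loglik_def ij)
    moreover have "c \<bullet> (fisher_info f (fst \<omega>s) *v b) = fisher_info f (fst \<omega>s) $ i $ j"
      by (simp add: ij inner_axis' matrix_vector_mult_basis column_def)
    moreover have "\<bar>\<delta> * m $ i $ j\<bar> \<le> \<delta>"
      using m \<delta> by (simp add: abs_mult mult_left_le)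
    ultimately show ?thesis by simp
  qed
  ultimately show ?thesis
    by simp
qed

text \<open>The quadratic term carries the Fisher matrix at the true parameter in place of the
  Hessian at \<open>\<phi>\<close>, so that positive definiteness can be used directly; the
  coefficient of the error vanishes with \<open>\<delta>\<close> and \<open>\<rho>\<close>.\<close>

lemma loglik_approximation_error:
  fixes f :: "real \<Rightarrow> real^'r \<Rightarrow> real" and \<omega>s :: "(real^'r) \<times> (real^'q)"
  assumes props: "sample_set_props f \<omega>s \<alpha> \<kappa> \<delta> \<epsilon> n X" and x: "x \<in> X" and \<delta>: "0 < \<delta>" and \<kappa>: "0 \<le> \<kappa>"
    and \<rho>: "norm (\<phi> - fst \<omega>s) + norm v \<le> \<rho>" "\<rho> \<le> \<alpha>"
  shows "\<bar>(1 / real n) * loglik f n x (\<phi> + v) - (1 / real n) * loglik f n x \<phi>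
      - ((1 / real n) *\<^sub>R score f n x \<phi>) \<bullet> v + (v \<bullet> (fisher_info f (fst \<omega>s) *v v)) / 2\<bar>
    \<le> (\<delta> + 2 * \<kappa> * real CARD('r) * \<rho>) * (real CARD('r))\<^sup>2 * (norm v)\<^sup>2"
proof -
  let ?F = "fisher_info f (fst \<omega>s)"
  let ?P = "\<lambda>b z. (1 / real n) * pderivs [b] (loglik f n x) z"
  have in_ball: "z \<in> cball (fst \<omega>s) \<rho>" if "z \<in> cball \<phi> (norm v)" for z
    using that \<rho> dist_triangle[of "fst \<omega>s" z \<phi>] by (simp add: dist_norm norm_minus_commute)
  have "\<bar>(1 / real n) * loglik f n x (\<phi> + v) - (1 / real n) * loglik f n x \<phi>
      - (\<Sum>b\<in>Basis. ?P b \<phi> * (v \<bullet> b)) + (v \<bullet> (?F *v v)) / 2\<bar>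
    \<le> (\<delta> + 2 * \<kappa> * real CARD('r) * \<rho>) * (real DIM(real^'r))\<^sup>2 * (norm v)\<^sup>2"
  proof (rule quadratic_approximation_error[where g = "\<lambda>z. (1 / real n) * loglik f n x z" and P = ?P
        and Q = "\<lambda>c b z. (1 / real n) * pderivs [c, b] (loglik f n x) z" and B = "(*v) ?F"])
    fix z b c :: "real^'r" assume z: "z \<in> cball \<phi> (norm v)" and b: "b \<in> Basis"
    have z': "z \<in> cball (fst \<omega>s) \<alpha>" and zn: "norm (z - fst \<omega>s) \<le> \<rho>"
      using in_ball[OF z] \<rho> by (auto simp: dist_norm norm_minus_commute)
    show "((\<lambda>u. (1 / real n) * loglik f n x (z + u *\<^sub>R b)) has_real_derivative ?P b z) (at 0)"
      using sample_derivatives(1)[OF props x z' b b b] by simp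
    assume c: "c \<in> Basis"
    show "((\<lambda>u. ?P b (z + u *\<^sub>R c)) has_real_derivative
        (1 / real n) * pderivs [c, b] (loglik f n x) z) (at 0)"
      by (rule sample_derivatives(2)[OF props x z' b c c])
    have "2 * \<kappa> * real CARD('r) * norm (z - fst \<omega>s) \<le> 2 * \<kappa> * real CARD('r) * \<rho>"
      using zn \<kappa> by (intro mult_left_mono) auto
    then show "\<bar>(1 / real n) * pderivs [c, b] (loglik f n x) z + c \<bullet> (?F *v b)\<bar>
        \<le> \<delta> + 2 * \<kappa> * real CARD('r) * \<rho>"
      using sample_hessian_error[OF props x \<delta> z' b c] by linarith
  next
    \<comment> \<open>The Fisher integrand is symmetric in its two indices by commutativity of the
      product.\<close>
    have "transpose ?F = ?F"
      by (simp add: transpose_def fisher_info_def fisher_integrand_def mult.commute)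
    then show "y \<bullet> (?F *v z) = z \<bullet> (?F *v y)" for y z
      by (metis dot_lmul_matrix inner_commute transpose_matrix_vector)
  qed (rule matrix_vector_mul_linear)
  moreover have "(\<Sum>b\<in>Basis. ?P b \<phi> * (v \<bullet> b)) = ((1 / real n) *\<^sub>R score f n x \<phi>) \<bullet> v"
    by (simp add: sum_Basis_cart inner_axis) (simp add: score_def inner_vec_def sum_divide_distrib)
  ultimately show ?thesis
    by simp
qed

text \<open>By (X2) the scaled score at the true parameter is below \<open>\<delta>\<^sup>2\<close>,
  hence below \<open>\<delta>\<close>, and a bound on the scaled Hessian makes it Lipschitz. The
  point is that \<open>S\<close> is chosen before \<open>\<delta>\<close>, \<open>n\<close> and the
  sample.\<close>

lemma score_bound:
  fixes f :: "real \<Rightarrow> real^'r \<Rightarrow> real" and \<omega>s :: "(real^'r) \<times> (real^'q)"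
  assumes \<alpha>: "0 < \<alpha>" and \<kappa>: "0 \<le> \<kappa>"
  obtains S where "0 \<le> S"
    "\<And>\<delta> \<epsilon> n X x \<phi>. sample_set_props f \<omega>s \<alpha> \<kappa> \<delta> \<epsilon> n X \<Longrightarrow> x \<in> X \<Longrightarrow> 0 < \<delta> \<Longrightarrow> \<delta> \<le> 1 \<Longrightarrow> \<delta> \<le> \<alpha> \<Longrightarrow>
      norm (\<phi> - fst \<omega>s) \<le> \<delta> \<Longrightarrow> norm ((1 / real n) *\<^sub>R score f n x \<phi>) \<le> S * \<delta>"
proof -
  let ?F = "fisher_info f (fst \<omega>s)"
  obtain M where M: "M > 0" "\<And>y. norm (?F *v y) \<le> M * norm y"
    using linear_bounded_pos[OF matrix_vector_mul_linear] by blast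
  define R where "R = real CARD('r)"
  \<comment> \<open>A bound for the second derivatives: \<open>M\<close> for the Fisher matrix on
    unit vectors, 1 for the error \<open>\<delta>\<close>, and the drift of the Hessian over the
    ball of radius \<open>\<alpha>\<close>.\<close>
  define N where "N = M + 1 + 2 * \<kappa> * R * \<alpha>"
  have N: "0 \<le> N" using M \<alpha> \<kappa> by (simp add: N_def R_def)
  show thesis
  proof (rule that[of "R * (1 + N * R)"])
    show "0 \<le> R * (1 + N * R)" using N by (simp add: R_def)
    fix \<delta> \<epsilon> n X x \<phi>
    assume props: "sample_set_props f \<omega>s \<alpha> \<kappa> \<delta> \<epsilon> n X" and x: "x \<in> X" and \<delta>: "0 < \<delta>" "\<delta> \<le> 1" "\<delta> \<le> \<alpha>"
      and \<phi>: "norm (\<phi> - fst \<omega>s) \<le> \<delta>"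
    have "\<bar>((1 / real n) *\<^sub>R score f n x \<phi>) $ i\<bar> \<le> (1 + N * R) * \<delta>" for i
    proof -
      let ?b = "axis i 1 :: real^'r"
      let ?P = "\<lambda>z. (1 / real n) * pderivs [?b] (loglik f n x) z"
      have b: "?b \<in> Basis" by (simp add: Basis_cart_real)
      have "\<bar>?P (fst \<omega>s + (\<phi> - fst \<omega>s)) - ?P (fst \<omega>s)\<bar> \<le> N * real DIM(real^'r) * norm (\<phi> - fst \<omega>s)"
      proof (rule coordinate_mean_value)
        fix z c :: "real^'r" assume "z \<in> cball (fst \<omega>s) (norm (\<phi> - fst \<omega>s))" and c: "c \<in> Basis"
        then have z: "z \<in> cball (fst \<omega>s) \<alpha>" and zn: "norm (z - fst \<omega>s) \<le> \<alpha>"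
          using \<phi> \<delta> by (auto simp: dist_norm norm_minus_commute)
        show "((\<lambda>u. ?P (z + u *\<^sub>R c)) has_real_derivative
            (1 / real n) * pderivs [c, ?b] (loglik f n x) z) (at 0)"
          by (rule sample_derivatives(2)[OF props x z b c c])
        have "\<bar>c \<bullet> (?F *v ?b)\<bar> \<le> M"
          using Cauchy_Schwarz_ineq2[of c "?F *v ?b"] M(2)[of ?b] c b by simp
        moreover have "2 * \<kappa> * R * norm (z - fst \<omega>s) \<le> 2 * \<kappa> * R * \<alpha>"
          using zn \<kappa> by (intro mult_left_mono) (auto simp: R_def)
        ultimately show "\<bar>(1 / real n) * pderivs [c, ?b] (loglik f n x) z\<bar> \<le> N"
          using sample_hessian_error[OF props x \<delta>(1) z b c] \<delta> unfolding N_def R_def by linarith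
      qed
      also have "\<dots> \<le> N * R * \<delta>"
        using \<phi> N by (simp add: R_def mult_left_mono)
      finally have "\<bar>?P \<phi> - ?P (fst \<omega>s)\<bar> \<le> N * R * \<delta>"
        by simp
      moreover have "\<bar>?P (fst \<omega>s)\<bar> \<le> \<delta>"
      proof -
        have "\<bar>?P (fst \<omega>s)\<bar> \<le> norm ((1 / real n) *\<^sub>R score f n x (fst \<omega>s))"
          using component_le_norm_cart[of "(1 / real n) *\<^sub>R score f n x (fst \<omega>s)" i]
          by (simp add: score_def)
        also have "\<dots> < \<delta>\<^sup>2"
          using props x unfolding sample_set_props_def by blast
        also have "\<dots> \<le> \<delta>"
          using \<delta> by (simp add: power2_eq_square mult_left_le)
        finally show ?thesis by simp
      qed
      moreover have "((1 / real n) *\<^sub>R score f n x \<phi>) $ i = ?P \<phi>"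
        by (simp add: score_def)
      ultimately show ?thesis
        by (simp only: distrib_right mult_1_left)
    qed
    then show "norm ((1 / real n) *\<^sub>R score f n x \<phi>) \<le> R * (1 + N * R) * \<delta>"
      using norm_le_card_mult_component_bound[of "(1 / real n) *\<^sub>R score f n x \<phi>"]
      by (simp only: R_def mult.assoc)
  qed
qed

section \<open>Choice of the radius and comparison with nearby feasible points\<close>

theorem mainTheorem2:
  fixes f :: "real \<Rightarrow> real^'r \<Rightarrow> real"
    and h :: "(real^'r) \<times> (real^'q) \<Rightarrow> real^'t"
    and \<omega>s :: "(real^'r) \<times> (real^'q)"
    and \<alpha> \<kappa>1 \<kappa>2 :: real
    and n\<^sub>0 :: "real \<Rightarrow> real \<Rightarrow> nat"
  assumes "CARD('q) \<le> CARD('t)" and "CARD('t) \<le> CARD('r)"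
    and "\<alpha> > 0"
    and "h \<omega>s = 0"
    and "density_conditions f \<omega>s \<alpha> \<kappa>1"
    and "constraint_conditions h \<omega>s \<alpha> \<kappa>2"
  shows "\<exists>\<delta>\<^sub>0. 0 < \<delta>\<^sub>0 \<and> \<delta>\<^sub>0 \<le> \<alpha> \<and>
    (\<forall>\<delta> \<epsilon>. 0 < \<delta> \<and> \<delta> < \<delta>\<^sub>0 \<and> 0 < \<epsilon> \<and> \<epsilon> < 1 \<longrightarrow>
      (\<exists>N\<ge>n\<^sub>0 \<delta> \<epsilon>. \<forall>n\<ge>N. \<forall>X. sample_set_props f \<omega>s \<alpha> \<kappa>1 \<delta> \<epsilon> n X \<longrightarrow>
        (\<forall>x\<in>X. \<forall>\<omega>h\<in>cball \<omega>s \<delta>. \<forall>lam :: real^'t.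
          (1 / real n) *\<^sub>R score f n x (fst \<omega>h) + Jmat h \<omega>h *v lam = 0 \<and>
          Kmat h \<omega>h *v lam = 0 \<and>
          h \<omega>h = 0 \<longrightarrow>
          (\<exists>V. open V \<and> \<omega>h \<in> V \<and>
            (\<forall>\<omega>\<in>V. h \<omega> = 0 \<longrightarrow> loglik f n x (fst \<omega>) \<le> loglik f n x (fst \<omega>h))))))"
proof -
  note \<alpha> = \<open>\<alpha> > 0\<close> and cc = \<open>constraint_conditions h \<omega>s \<alpha> \<kappa>2\<close>
  let ?F = "fisher_info f (fst \<omega>s)"
  define R where "R = real CARD('r)"
  obtain c where c: "c > 0" "\<And>v. c * (norm v)\<^sup>2 \<le> v \<bullet> (?F *v v)"
    using assms(5) posdef_lower_bound[of ?F] unfolding density_conditions_def by blast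
  obtain C \<rho> where C: "0 \<le> C" and \<rho>: "0 < \<rho>" "2 * \<rho> < \<alpha>"
    and feasible: "\<And>x v g lam. norm (x - \<omega>s) \<le> \<rho> \<Longrightarrow> norm v \<le> \<rho> \<Longrightarrow> g + Jmat h x *v lam = 0 \<Longrightarrow>
      Kmat h x *v lam = 0 \<Longrightarrow> h x = 0 \<Longrightarrow> h (x + v) = 0 \<Longrightarrow>
      g \<bullet> fst v \<le> C * norm g * (norm (fst v))\<^sup>2"
    using feasible_gradient_bound[OF cc \<alpha>] by metis
  \<comment> \<open>The maximum makes the constant nonnegative by construction, and the sample
    conditions weaken to it.\<close>
  define \<kappa> where "\<kappa> = max \<kappa>1 0"
  obtain S where S: "0 \<le> S"
    "\<And>\<delta> \<epsilon> n X x \<phi>. sample_set_props f \<omega>s \<alpha> \<kappa> \<delta> \<epsilon> n X \<Longrightarrow> x \<in> X \<Longrightarrow> 0 < \<delta> \<Longrightarrow> \<delta> \<le> 1 \<Longrightarrow> \<delta> \<le> \<alpha> \<Longrightarrow>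
      norm (\<phi> - fst \<omega>s) \<le> \<delta> \<Longrightarrow> norm ((1 / real n) *\<^sub>R score f n x \<phi>) \<le> S * \<delta>"
    using score_bound[OF \<alpha>, of \<kappa> f \<omega>s] unfolding \<kappa>_def by (metis max.cobounded2)
  \<comment> \<open>The bracket collects the gradient contribution \<open>C * S\<close> and the
    expansion error at radius \<open>2 * \<delta>\<close>; together they must stay below
    \<open>c / 2\<close>, the coercivity constant of half the Fisher form. The bounds 1 and
    \<open>\<rho>\<close> admit the score estimate and the feasibility estimate.\<close>
  have "\<forall>\<^sub>F \<delta>\<^sub>0 in at_right 0. (C * S + (1 + 4 * \<kappa> * R) * R\<^sup>2) * \<delta>\<^sub>0 < c / 2 \<and>
      1 * \<delta>\<^sub>0 < 1 \<and> 1 * \<delta>\<^sub>0 < \<rho> \<and> 0 < \<delta>\<^sub>0"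
    using c(1) \<rho>(1)
    by (intro eventually_conj eventually_at_right_mult_less) (auto simp: eventually_at_right_less)
  then obtain \<delta>\<^sub>0 where \<delta>\<^sub>0: "(C * S + (1 + 4 * \<kappa> * R) * R\<^sup>2) * \<delta>\<^sub>0 < c / 2" "\<delta>\<^sub>0 < 1" "\<delta>\<^sub>0 < \<rho>" "0 < \<delta>\<^sub>0"
    using eventually_happens'[OF trivial_limit_at_right_real] by (metis (no_types, lifting) mult_1)
  have local_max: "loglik f n x (fst \<omega>) \<le> loglik f n x (fst \<omega>h)"
    if \<delta>: "0 < \<delta>" "\<delta> < \<delta>\<^sub>0" and n: "1 \<le> n" and props1: "sample_set_props f \<omega>s \<alpha> \<kappa>1 \<delta> \<epsilon> n X"
      and x: "x \<in> X" and \<omega>h: "\<omega>h \<in> cball \<omega>s \<delta>"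
      and stat: "(1 / real n) *\<^sub>R score f n x (fst \<omega>h) + Jmat h \<omega>h *v lam = 0"
        "Kmat h \<omega>h *v lam = 0" and feas: "h \<omega>h = 0" "h \<omega> = 0" and \<omega>: "\<omega> \<in> ball \<omega>h \<delta>"
    for \<delta> \<epsilon> n X x \<omega>h lam \<omega>
  proof -
    have props: "sample_set_props f \<omega>s \<alpha> \<kappa> \<delta> \<epsilon> n X"
    proof -
      have "2 * \<kappa>1 \<le> 2 * \<kappa>" by (simp add: \<kappa>_def)
      with props1 show ?thesis
        unfolding sample_set_props_def using less_le_trans by blast
    qed
    define v where "v = \<omega> - \<omega>h"
    let ?a = "fst v" and ?g = "(1 / real n) *\<^sub>R score f n x (fst \<omega>h)"
    have near: "norm (\<omega>h - \<omega>s) \<le> \<delta>" "norm v \<le> \<delta>"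
      using \<omega>h \<omega> by (auto simp: v_def dist_norm norm_minus_commute)
    have norm_fst: "norm (fst w) \<le> norm w" for w :: "(real^'r) \<times> (real^'q)"
      by (metis norm_fst_le prod.collapse)
    have near_fst: "norm (fst \<omega>h - fst \<omega>s) \<le> \<delta>" "norm ?a \<le> \<delta>"
      using near order_trans[OF norm_fst] by (auto simp flip: fst_diff)
    have "?g \<bullet> ?a \<le> C * norm ?g * (norm ?a)\<^sup>2"
      by (rule feasible[OF _ _ stat feas(1)]) (use near \<delta> \<delta>\<^sub>0 feas in \<open>auto simp: v_def\<close>)
    also have "\<dots> \<le> C * (S * \<delta>) * (norm ?a)\<^sup>2"
      using S(2)[OF props x \<delta>(1) _ _ near_fst(1)] \<delta> \<delta>\<^sub>0 \<rho> C
      by (intro mult_right_mono mult_left_mono) auto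
    finally have grad: "?g \<bullet> ?a \<le> C * S * \<delta> * (norm ?a)\<^sup>2"
      by (simp add: mult.assoc)
    \<comment> \<open>The radius is \<open>2 * \<delta>\<close>: one \<open>\<delta>\<close> for the
      distance of the solution from the true parameter, one for the increment.\<close>
    have "\<bar>(1 / real n) * loglik f n x (fst \<omega>h + ?a) - (1 / real n) * loglik f n x (fst \<omega>h)
        - ?g \<bullet> ?a + (?a \<bullet> (?F *v ?a)) / 2\<bar> \<le> (\<delta> + 2 * \<kappa> * R * (2 * \<delta>)) * R\<^sup>2 * (norm ?a)\<^sup>2"
      unfolding R_def
      by (rule loglik_approximation_error[OF props x \<delta>(1)])
        (use near_fst \<delta> \<delta>\<^sub>0 \<rho> in \<open>auto simp: \<kappa>_def\<close>)
    then have "(1 / real n) * loglik f n x (fst \<omega>) - (1 / real n) * loglik f n x (fst \<omega>h)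
        \<le> C * S * \<delta> * (norm ?a)\<^sup>2 - c / 2 * (norm ?a)\<^sup>2 + (\<delta> + 2 * \<kappa> * R * (2 * \<delta>)) * R\<^sup>2 * (norm ?a)\<^sup>2"
      using grad c(2)[of ?a] by (simp add: v_def)
    also have "\<dots> = ((C * S + (1 + 4 * \<kappa> * R) * R\<^sup>2) * \<delta> - c / 2) * (norm ?a)\<^sup>2"
      by (simp add: algebra_simps)
    also have "\<dots> \<le> 0"
    proof (rule mult_nonpos_nonneg)
      have "(C * S + (1 + 4 * \<kappa> * R) * R\<^sup>2) * \<delta> \<le> (C * S + (1 + 4 * \<kappa> * R) * R\<^sup>2) * \<delta>\<^sub>0"
        using \<delta> C S by (intro mult_left_mono) (auto simp: \<kappa>_def R_def)
      then show "(C * S + (1 + 4 * \<kappa> * R) * R\<^sup>2) * \<delta> - c / 2 \<le> 0"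
        using \<delta>\<^sub>0 by linarith
    qed simp
    finally show ?thesis
      using n by (simp add: divide_right_mono field_simps)
  qed
  show ?thesis
  proof (intro exI[of _ \<delta>\<^sub>0] conjI allI impI)
    fix \<delta> \<epsilon> :: real
    assume \<delta>: "0 < \<delta> \<and> \<delta> < \<delta>\<^sub>0 \<and> 0 < \<epsilon> \<and> \<epsilon> < 1"
    show "\<exists>N\<ge>n\<^sub>0 \<delta> \<epsilon>. \<forall>n\<ge>N. \<forall>X. sample_set_props f \<omega>s \<alpha> \<kappa>1 \<delta> \<epsilon> n X \<longrightarrow>
        (\<forall>x\<in>X. \<forall>\<omega>h\<in>cball \<omega>s \<delta>. \<forall>lam :: real^'t.
          (1 / real n) *\<^sub>R score f n x (fst \<omega>h) + Jmat h \<omega>h *v lam = 0 \<and>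
          Kmat h \<omega>h *v lam = 0 \<and>
          h \<omega>h = 0 \<longrightarrow>
          (\<exists>V. open V \<and> \<omega>h \<in> V \<and>
            (\<forall>\<omega>\<in>V. h \<omega> = 0 \<longrightarrow> loglik f n x (fst \<omega>) \<le> loglik f n x (fst \<omega>h))))"
    \<comment> \<open>All constants are independent of \<open>n\<close>, so beyond the given
      threshold only \<open>n \<ge> 1\<close> is asked for, which allows the factor
      \<open>1 / real n\<close> to be cancelled. The neighborhood is the ball of radius
      \<open>\<delta>\<close> about the solution.\<close>
    proof (intro exI[of _ "max 1 (n\<^sub>0 \<delta> \<epsilon>)"] conjI allI ballI impI)
      fix n X x \<omega>h lam
      assume "max 1 (n\<^sub>0 \<delta> \<epsilon>) \<le> n" "sample_set_props f \<omega>s \<alpha> \<kappa>1 \<delta> \<epsilon> n X" "x \<in> X" "\<omega>h \<in> cball \<omega>s \<delta>"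
        "(1 / real n) *\<^sub>R score f n x (fst \<omega>h) + Jmat h \<omega>h *v lam = 0 \<and>
          Kmat h \<omega>h *v lam = 0 \<and> h \<omega>h = 0"
      then show "\<exists>V. open V \<and> \<omega>h \<in> V \<and>
          (\<forall>\<omega>\<in>V. h \<omega> = 0 \<longrightarrow> loglik f n x (fst \<omega>) \<le> loglik f n x (fst \<omega>h))"
        using local_max[of \<delta> n \<epsilon> X x \<omega>h lam] \<delta>
        by (intro exI[of _ "ball \<omega>h \<delta>"]) auto
    qed simp
  qed (use \<delta>\<^sub>0 \<rho> in auto)
qed

end
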